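(* The group $\mathsf{Shuffler}(\mathbb{Z})=\mathrm{FSym}(\mathbb{Z})\rtimes\mathbb{Z}$ admits a probability measure $\mu$ with an infinite first moment and with a finite $(1-\varepsilon)$-moment for every $0<\varepsilon<1$, that induces a transient random walk on $\mathbb{Z}$ and for which the permutation coordinate of the $\mu$-random walk does not stabilize. Moreover, such a measure can be chosen to satisfy $\mathbb{E}(|\mathrm{supp}(\sigma_1)|)=\infty$ and $\mathbb{E}(|\mathrm{supp}(\sigma_1)|^{1-\varepsilon})<\infty$ for every $0<\varepsilon<1$, where $\sigma_1$ denotes the $\mathrm{FSym}(\mathbb{Z})$-component of a $\mu$-distributed increment.
   Context: $\mathrm{FSym}(\mathbb{Z})$ is the group (under composition) of bijections $f:\mathbb{Z}\to\mathbb{Z}$ with finite support $\mathrm{supp}(f)=\{x: f(x)\neq x\}$. $\mathbb{Z}$ acts on it by $(h\cdot f)(x)=h+f(x-h)$, and $\mathsf{Shuffler}(\mathbb{Z}):=\mathrm{FSym}(\mathbb{Z})\rtimes\mathbb{Z}$ with product $(f,x)(g,y)=(f\circ(x\cdot g),x+y)$. This group is finitely generated. For $\alpha>0$, $\mu$ has a finite $\alpha$-moment if $\sum_g\ell(g)^\alpha\mu(g)<\infty$ for some (equivalently, any) word length $\ell$ on $\mathsf{Shuffler}(\mathbb{Z})$ associated with a finite generating set; it has an infinite first moment if this fails for $\alpha=1$. The $\mu$-random walk is $(F_n,S_n)=g_1\cdots g_n$ with $g_i=(\sigma_i,X_i)$ i.i.d. of law $\mu$, started at the identity; $F_n$ is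 the permutation coordinate. The induced random walk on $\mathbb{Z}$ is $\{S_n\}$; it is transient if almost surely it visits $0$ only finitely many times. The permutation coordinate stabilizes if almost surely, for every $h\in\mathbb{Z}$ there exists $N\ge1$ with $F_n(h)=F_N(h)$ for all $n\ge N$. *)

theory Defs
  imports "HOL-Probability.Probability" "HOL-Algebra.Generated_Groups" "HOL-Combinatorics.Perm"
begin

section \<open>The group FSym(Z) \<rtimes> Z\<close>

text \<open>
  The library type \<open>int perm\<close> consists of exactly the bijections of the integers with finite
  support; its multiplication is composition and \<open>affected f\<close> is the support of \<open>f\<close>.
\<close>

unbundle permutation_syntax

lift_definition translate :: "int \<Rightarrow> int perm \<Rightarrow> int perm"
  is "\<lambda>h f x. h + f (x - h)"
proof
  fix h :: int and f :: "int \<Rightarrow> int"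
  assume f: "bij f \<and> finite {a. f a \<noteq> a}"
  have "bij ((\<lambda>x. h + x) \<circ> f \<circ> (\<lambda>x. x - h))"
    using f by (intro bij_comp o_bij[of "\<lambda>x. x + h" "\<lambda>x. x - h"]
        o_bij[of "\<lambda>x. x - h" "\<lambda>x. h + x"]) auto
  then show "bij (\<lambda>x. h + f (x - h))"
    by (simp add: comp_def)
  have "{x. h + f (x - h) \<noteq> x} \<subseteq> (\<lambda>x. h + x) ` {a. f a \<noteq> a}"
  proof
    fix x assume "x \<in> {x. h + f (x - h) \<noteq> x}"
    then have "x - h \<in> {a. f a \<noteq> a}" "x = h + (x - h)" by auto
    then show "x \<in> (\<lambda>x. h + x) ` {a. f a \<noteq> a}" by blast
  qed
  then show "finite {x. h + f (x - h) \<noteq> x}"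
    using f by (meson finite_imageI finite_subset)
qed

definition Shuffler :: "(int perm \<times> int) monoid"
  where "Shuffler = \<lparr>carrier = UNIV,
    monoid.mult = (\<lambda>(f, x) (g, y). (f * translate x g, x + y)),
    one = (1, 0)\<rparr>"

lemma carrier_Shuffler [simp]: "carrier Shuffler = UNIV"
  and one_Shuffler [simp]: "\<one>\<^bsub>Shuffler\<^esub> = (1, 0)"
  and mult_Shuffler [simp]: "(f, x) \<otimes>\<^bsub>Shuffler\<^esub> (g, y) = (f * translate x g, x + y)"
  by (simp_all add: Shuffler_def)

lemma translate_times: "translate h (f * g) = translate h f * translate h g"
  by transfer (simp add: fun_eq_iff)

lemma translate_translate: "translate h (translate k f) = translate (h + k) f"
  by transfer (simp add: fun_eq_iff algebra_simps)

lemma translate_zero [simp]: "translate 0 f = f"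
  by transfer simp

lemma translate_one [simp]: "translate h 1 = 1"
  by transfer (simp add: fun_eq_iff)

lemma group_Shuffler: "group Shuffler"
proof (rule groupI)
  fix a assume "a \<in> carrier Shuffler"
  obtain f x where a: "a = (f, x)" by (cases a)
  have "(translate (- x) (inverse f), - x) \<otimes>\<^bsub>Shuffler\<^esub> a = \<one>\<^bsub>Shuffler\<^esub>"
    by (simp add: a flip: translate_times)
  then show "\<exists>b\<in>carrier Shuffler. b \<otimes>\<^bsub>Shuffler\<^esub> a = \<one>\<^bsub>Shuffler\<^esub>" by auto
qed (auto simp: translate_times translate_translate mult.assoc add.assoc)


section \<open>Word length and moments\<close>

definition finite_generating_set :: "('a, 'b) monoid_scheme \<Rightarrow> 'a set \<Rightarrow> bool"
  where "finite_generating_set G S \<longleftrightarrow>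
    finite S \<and> S \<subseteq> carrier G \<and> generate G S = carrier G"

definition word_length :: "('a, 'b) monoid_scheme \<Rightarrow> 'a set \<Rightarrow> 'a \<Rightarrow> nat"
  where "word_length G S g = (LEAST n. \<exists>ws. length ws = n
    \<and> set ws \<subseteq> S \<union> (\<lambda>s. inv\<^bsub>G\<^esub> s) ` S
    \<and> foldr (\<otimes>\<^bsub>G\<^esub>) ws \<one>\<^bsub>G\<^esub> = g)"

definition finite_moment :: "(int perm \<times> int) pmf \<Rightarrow> real \<Rightarrow> bool"
  where "finite_moment \<mu> \<alpha> \<longleftrightarrow> (\<exists>S. finite_generating_set Shuffler S
    \<and> (\<lambda>g. real (word_length Shuffler S g) powr \<alpha> * pmf \<mu> g) summable_on UNIV)"


section \<open>The random walk\<close>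

text \<open>The i.i.d. increments are the coordinates of the product space; \<open>\<omega> i\<close> is the
  increment with index \<open>i + 1\<close>.\<close>

definition increments :: "(int perm \<times> int) pmf \<Rightarrow> (nat \<Rightarrow> int perm \<times> int) measure"
  where "increments \<mu> = Pi\<^sub>M UNIV (\<lambda>_. measure_pmf \<mu>)"

fun walk :: "(nat \<Rightarrow> int perm \<times> int) \<Rightarrow> nat \<Rightarrow> int perm \<times> int"
  where
    "walk \<omega> 0 = \<one>\<^bsub>Shuffler\<^esub>"
  | "walk \<omega> (Suc n) = walk \<omega> n \<otimes>\<^bsub>Shuffler\<^esub> \<omega> n"

definition induced_walk_transient :: "(int perm \<times> int) pmf \<Rightarrow> bool"
  where "induced_walk_transient \<mu> \<longleftrightarrow>
    (AE \<omega> in increments \<mu>. finite {n. snd (walk \<omega> n) = 0})"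

definition permutation_stabilizes :: "(int perm \<times> int) pmf \<Rightarrow> bool"
  where "permutation_stabilizes \<mu> \<longleftrightarrow>
    (AE \<omega> in increments \<mu>. \<forall>h. \<exists>N\<ge>1. \<forall>n\<ge>N.
      fst (walk \<omega> n) \<langle>$\<rangle> h = fst (walk \<omega> N) \<langle>$\<rangle> h)"

end

theory Submission
  imports Defs "HOL-Real_Asymp.Real_Asymp"
begin

text \<open>
  Take the drift to be deterministic, \<open>X\<^sub>i = -1\<close>, and let \<open>\<sigma>\<^sub>i\<close> be the cycle
  \<open>(0 1 \<dots> r)\<close> with probability \<open>1 / ((r + 1) (r + 2))\<close>, so that \<open>P (r \<ge> n) = 1 / (n + 1)\<close>.
  At step \<open>n\<close> the image of \<open>0\<close> under the permutation coordinate changes exactly when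
  \<open>n \<in> supp \<sigma>\<close>, that is, with probability of order \<open>1 / n\<close>. These independent events have
  divergent total probability, so the image of \<open>0\<close> changes infinitely often. The cycle
  \<open>(0 1 \<dots> r)\<close> has word length comparable to \<open>r\<close>: from below because the size of the support is
  at most linear in the word length, and from above because
  \<open>((0 1), 1)\<^sup>r = ((0 1 \<dots> r), r)\<close>.
\<close>

section \<open>Word length\<close>

lemma (in group) foldr_mult_foldr:
  assumes "set us \<subseteq> carrier G" "set vs \<subseteq> carrier G"
  shows "foldr (\<otimes>) us (foldr (\<otimes>) vs \<one>) = foldr (\<otimes>) us \<one> \<otimes> foldr (\<otimes>) vs \<one>"
proof -
  have closed: "foldr (\<otimes>) ws \<one> \<in> carrier G" if "set ws \<subseteq> carrier G" for ws
    using that by (induction ws) auto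
  show ?thesis
    using assms(1) by (induction us) (auto simp: closed assms(2) m_assoc)
qed

text \<open>Words are closed under concatenation, which matches the product rule of
  \<open>generate\<close>. This bridges the inductive closure and the lists of letters in
  \<open>word_length\<close>.\<close>

lemma (in group) generate_imp_word:
  assumes "S \<subseteq> carrier G" "g \<in> generate G S"
  shows "\<exists>ws. set ws \<subseteq> S \<union> (\<lambda>s. inv s) ` S \<and> foldr (\<otimes>) ws \<one> = g"
  using assms(2)
proof induction
  case one
  show ?case by (intro exI[of _ "[]"]) auto
next
  case (incl h)
  then show ?case using assms(1) by (intro exI[of _ "[h]"]) auto
next
  case (inv h)
  then show ?case using assms(1) by (intro exI[of _ "[inv h]"]) auto
next
  case (eng h1 h2)
  then obtain us vs
    where us: "set us \<subseteq> S \<union> (\<lambda>s. inv s) ` S" "foldr (\<otimes>) us \<one> = h1"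
      and vs: "set vs \<subseteq> S \<union> (\<lambda>s. inv s) ` S" "foldr (\<otimes>) vs \<one> = h2"
    by blast
  have "S \<union> (\<lambda>s. inv s) ` S \<subseteq> carrier G"
    using assms(1) by auto
  with us vs have "set us \<subseteq> carrier G" "set vs \<subseteq> carrier G"
    by blast+
  then show ?case
    using us vs by (intro exI[of _ "us @ vs"]) (auto simp: foldr_mult_foldr)
qed

text \<open>Generation supplies at least one word for \<open>g\<close>, so the \<open>LEAST\<close>
  in \<open>word_length\<close> ranges over a nonempty set and is attained.\<close>

lemma (in group) word_length_word:
  assumes "finite_generating_set G S" "g \<in> carrier G"
  shows "\<exists>ws. length ws = word_length G S g \<and> set ws \<subseteq> S \<union> (\<lambda>s. inv s) ` S
    \<and> foldr (\<otimes>) ws \<one> = g"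
proof -
  define P where "P n \<longleftrightarrow> (\<exists>ws. length ws = n \<and> set ws \<subseteq> S \<union> (\<lambda>s. inv s) ` S
    \<and> foldr (\<otimes>) ws \<one> = g)" for n
  have "\<exists>n. P n"
    using assms generate_imp_word[of S g] by (auto simp: finite_generating_set_def P_def)
  then have "P (Least P)"
    by (rule LeastI_ex)
  moreover have "Least P = word_length G S g"
    by (simp add: word_length_def P_def[abs_def])
  ultimately show ?thesis
    by (simp add: P_def)
qed

lemma word_length_le:
  assumes "set ws \<subseteq> S \<union> (\<lambda>s. inv\<^bsub>G\<^esub> s) ` S" "foldr (\<otimes>\<^bsub>G\<^esub>) ws \<one>\<^bsub>G\<^esub> = g"
  shows "word_length G S g \<le> length ws"
  unfolding word_length_def using assms by (intro Least_le) blast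

lemma (in group) word_length_mult_le:
  assumes S: "finite_generating_set G S" and gh: "g \<in> carrier G" "h \<in> carrier G"
  shows "word_length G S (g \<otimes> h) \<le> word_length G S g + word_length G S h"
proof -
  obtain us vs
    where us: "length us = word_length G S g" "set us \<subseteq> S \<union> (\<lambda>s. inv s) ` S"
        "foldr (\<otimes>) us \<one> = g"
      and vs: "length vs = word_length G S h" "set vs \<subseteq> S \<union> (\<lambda>s. inv s) ` S"
        "foldr (\<otimes>) vs \<one> = h"
    using word_length_word[OF S] gh by metis
  have "S \<union> (\<lambda>s. inv s) ` S \<subseteq> carrier G"
    using S by (auto simp: finite_generating_set_def)
  with us vs have "set us \<subseteq> carrier G" "set vs \<subseteq> carrier G"
    by blast+
  then have "word_length G S (g \<otimes> h) \<le> length (us @ vs)"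
    using us vs by (intro word_length_le) (auto simp: foldr_mult_foldr)
  then show ?thesis
    using us vs by simp
qed

lemma (in group) word_length_generator_le:
  assumes "S \<subseteq> carrier G" "s \<in> S \<union> (\<lambda>s. inv s) ` S"
  shows "word_length G S s \<le> 1"
proof -
  have "s \<in> carrier G"
    using assms by auto
  then show ?thesis
    using word_length_le[of "[s]" S G s] assms(2) by simp
qed

lemma word_length_one [simp]: "word_length G S \<one>\<^bsub>G\<^esub> = 0"
  using word_length_le[of "[]" S G "\<one>\<^bsub>G\<^esub>"] by simp


section \<open>Generators of the group and the size of supports\<close>

lemma apply_translate: "translate h f \<langle>$\<rangle> x = h + f \<langle>$\<rangle> (x - h)"
  by transfer simp

lemma card_affected_translate: "card (affected (translate h f)) = card (affected f)"
proof -
  have "affected (translate h f) = (\<lambda>x. h + x) ` affected f"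
    by (auto simp: in_affected apply_translate intro: image_eqI[of _ _ "_ - h"])
  then show ?thesis
    by (simp add: card_image)
qed

lemma translate_swap: "translate h \<langle>a \<leftrightarrow> b\<rangle> = \<langle>h + a \<leftrightarrow> h + b\<rangle>"
  by (rule perm_eqI) (auto simp: apply_translate Transposition.transpose_def swap.rep_eq)

lemma inv_Shuffler: "inv\<^bsub>Shuffler\<^esub> (f, x) = (translate (- x) (inverse f), - x)"
proof (rule group.inv_equality[OF group_Shuffler])
  show "(translate (- x) (inverse f), - x) \<otimes>\<^bsub>Shuffler\<^esub> (f, x) = \<one>\<^bsub>Shuffler\<^esub>"
    by (simp flip: translate_times)
qed auto

lemma card_affected_mult_le:
  "card (affected (fst (g \<otimes>\<^bsub>Shuffler\<^esub> h))) \<le> card (affected (fst g)) + card (affected (fst h))"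
proof -
  obtain f x f' y where gh: "g = (f, x)" "h = (f', y)"
    by (metis surj_pair)
  have "card (affected (f * translate x f')) \<le> card (affected f \<union> affected (translate x f'))"
    by (intro card_mono) auto
  also have "\<dots> \<le> card (affected f) + card (affected (translate x f'))"
    by (rule card_Un_le)
  also have "card (affected (translate x f')) = card (affected f')"
    by (rule card_affected_translate)
  finally show ?thesis
    by (simp add: gh)
qed

text \<open>Support size is subadditive along a word, so any \<open>K\<close> bounding the support
  of every letter works. This holds for an arbitrary finite generating set, which is what refuting
  the existential in \<open>finite_moment\<close> requires.\<close>

lemma card_affected_le_word_length:
  assumes S: "finite_generating_set Shuffler S"
  obtains K where "\<And>g. card (affected (fst g)) \<le> K * word_length Shuffler S g"
proof -
  interpret group Shuffler by (rule group_Shuffler)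
  define T where "T = S \<union> (\<lambda>s. inv\<^bsub>Shuffler\<^esub> s) ` S"
  \<comment> \<open>A sum over all letters serves as a crude upper bound for their maximum.\<close>
  define K where "K = (\<Sum>s\<in>T. card (affected (fst s)))"
  have "finite T"
    using S by (simp add: T_def finite_generating_set_def)
  then have K: "card (affected (fst s)) \<le> K" if "s \<in> T" for s
    unfolding K_def using that by (intro member_le_sum) auto
  have word: "card (affected (fst (foldr (\<otimes>\<^bsub>Shuffler\<^esub>) ws \<one>\<^bsub>Shuffler\<^esub>))) \<le> K * length ws"
    if "set ws \<subseteq> T" for ws
    using that
  proof (induction ws)
    case (Cons s ws)
    then show ?case
      using card_affected_mult_le[of s "foldr (\<otimes>\<^bsub>Shuffler\<^esub>) ws \<one>\<^bsub>Shuffler\<^esub>"] K[of s] by auto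
  qed auto
  have "card (affected (fst g)) \<le> K * word_length Shuffler S g" for g
    using word_length_word[OF S, of g] word by (metis T_def UNIV_I carrier_Shuffler)
  then show ?thesis
    by (rule that)
qed

section \<open>One transposition and the unit shift generate the group\<close>

definition std_gens :: "(int perm \<times> int) set"
  where "std_gens = {(\<langle>0 \<leftrightarrow> 1\<rangle>, 0), (1, 1)}"

lemma shift_in_generate: "(1, k) \<in> generate Shuffler std_gens"
proof (induction k rule: int_induct[of _ 0])
  case base
  show ?case using generate.one[of Shuffler std_gens] by simp
next
  case (step1 i)
  have "(1, 1) \<in> generate Shuffler std_gens"
    by (rule generate.incl) (simp add: std_gens_def)
  from generate.eng[OF step1(2) this] show ?case by simp
next
  case (step2 i)
  have "inv\<^bsub>Shuffler\<^esub> (1, 1) \<in> generate Shuffler std_gens"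
    by (rule generate.inv) (simp add: std_gens_def)
  from generate.eng[OF step2(2) this] show ?case by (simp add: inv_Shuffler)
qed

text \<open>Translation by \<open>k\<close> is conjugation by the pure shift
  \<open>(1, k)\<close>.\<close>

lemma generate_translate:
  assumes "(f, 0) \<in> generate Shuffler std_gens"
  shows "(translate k f, 0) \<in> generate Shuffler std_gens"
  using generate.eng[OF generate.eng[OF shift_in_generate[of k] assms] shift_in_generate[of "- k"]]
  by simp

text \<open>Conjugating the swap of 0 and \<open>n\<close> by the adjacent swap of \<open>n\<close>
  and \<open>n + 1\<close> carries it to the swap of 0 and \<open>n + 1\<close>.\<close>

lemma swap_0_in_generate: "(\<langle>0 \<leftrightarrow> int n\<rangle>, 0) \<in> generate Shuffler std_gens"
proof (induction n)
  case 0
  show ?case using generate.one[of Shuffler std_gens] by simp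
next
  case (Suc n)
  have "(\<langle>0 \<leftrightarrow> 1\<rangle>, 0) \<in> generate Shuffler std_gens"
    by (rule generate.incl) (simp add: std_gens_def)
  from generate_translate[OF this, of "int n"]
  have adj: "(\<langle>int n \<leftrightarrow> int (Suc n)\<rangle>, 0) \<in> generate Shuffler std_gens"
    by (simp add: translate_swap add.commute)
  show ?case
  \<comment> \<open>For \<open>n = 0\<close> the conjugated swap is the identity, so the conjugation
    yields nothing; there the adjacent swap is itself the goal.\<close>
  proof (cases "n = 0")
    case False
    then have "\<langle>int n \<leftrightarrow> int (Suc n)\<rangle> * \<langle>0 \<leftrightarrow> int n\<rangle> * \<langle>int n \<leftrightarrow> int (Suc n)\<rangle> = \<langle>0 \<leftrightarrow> int (Suc n)\<rangle>"
      by (intro perm_eqI) (auto simp: apply_times swap.rep_eq Transposition.transpose_def)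
    with generate.eng[OF generate.eng[OF adj Suc.IH] adj] show ?thesis
      by simp
  qed (use adj in simp)
qed

lemma swap_in_generate: "(\<langle>a \<leftrightarrow> b\<rangle>, 0) \<in> generate Shuffler std_gens"
proof -
  have le: "(\<langle>a \<leftrightarrow> b\<rangle>, 0) \<in> generate Shuffler std_gens" if "a \<le> b" for a b
    using generate_translate[OF swap_0_in_generate[of "nat (b - a)"], of a] that
    by (simp add: translate_swap)
  show ?thesis
    using le[of a b] le[of b a] by (cases "a \<le> b") (simp_all add: swap_sym[of a b])
qed

text \<open>Induction on the support size: composing \<open>f\<close> with the swap of a moved point
  \<open>a\<close> and its image makes \<open>a\<close> fixed and moves no new point.\<close>

lemma perm_in_generate: "(f, 0) \<in> generate Shuffler std_gens"
proof (induction "card (affected f)" arbitrary: f rule: less_induct)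
  case less
  show ?case
  proof (cases "f = 1")
    case True
    then show ?thesis using generate.one[of Shuffler std_gens] by simp
  next
    case False
    then obtain a where a: "a \<in> affected f"
      using affected_empty_iff[of f] by blast
    define b where "b = f \<langle>$\<rangle> a"
    define g where "g = \<langle>a \<leftrightarrow> b\<rangle> * f"
    have "affected g \<subseteq> affected f"
    proof
      fix x assume "x \<in> affected g"
      \<comment> \<open>The image \<open>b\<close> of \<open>a\<close> is moved too: otherwise
        \<open>a\<close> and \<open>b\<close> would have the same image under \<open>f\<close>,
        hence be equal. So the swap only involves points of the support.\<close>
      moreover have "f \<langle>$\<rangle> b \<noteq> b"
        using a by (metis b_def apply_inj in_affected)
      ultimately show "x \<in> affected f"
        using a by (auto simp: in_affected g_def apply_times swap.rep_eq Transposition.transpose_def split: if_splits)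
    qed
    moreover have "a \<notin> affected g"
      by (simp add: g_def in_affected apply_times b_def)
    ultimately have "card (affected g) < card (affected f)"
      using a by (intro psubset_card_mono) auto
    from generate.eng[OF swap_in_generate[of a b] less[OF this]]
    have "(\<langle>a \<leftrightarrow> b\<rangle> * g, 0) \<in> generate Shuffler std_gens"
      by simp
    moreover have "\<langle>a \<leftrightarrow> b\<rangle> * g = f"
      unfolding g_def by (intro perm_eqI) (simp add: apply_times swap.rep_eq)
    ultimately show ?thesis
      by simp
  qed
qed

lemma finite_generating_set_std_gens: "finite_generating_set Shuffler std_gens"
proof -
  have "(f, k) \<in> generate Shuffler std_gens" for f k
    using generate.eng[OF perm_in_generate[of f] shift_in_generate[of k]] by simp
  then show ?thesis
    by (auto simp: finite_generating_set_def std_gens_def)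
qed


section \<open>The cycles\<close>

text \<open>The product of adjacent transpositions (0 1)(1 2)...(r-1 r), that is, the cycle sending
  each point below \<open>r\<close> to its successor and \<open>r\<close> to 0. In this form, each
  recursion step is right multiplication of \<open>(interval_cycle r, int r)\<close> by
  \<open>(\<langle>0 \<leftrightarrow> 1\<rangle>, 1)\<close>.\<close>

fun interval_cycle :: "nat \<Rightarrow> int perm"
  where
    "interval_cycle 0 = 1"
  | "interval_cycle (Suc r) = interval_cycle r * translate (int r) \<langle>0 \<leftrightarrow> 1\<rangle>"

lemma apply_interval_cycle:
  "interval_cycle r \<langle>$\<rangle> x = (if 0 \<le> x \<and> x < int r then x + 1 else if x = int r then 0 else x)"
proof (induction r arbitrary: x)
  case (Suc r)
  show ?case
    by (auto simp: apply_times Suc.IH translate_swap swap.rep_eq Transposition.transpose_def)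
qed auto

lemma affected_interval_cycle: "affected (interval_cycle r) = (if r = 0 then {} else {0..int r})"
  by (auto simp: in_affected apply_interval_cycle split: if_splits)

lemma inj_interval_cycle: "inj interval_cycle"
proof (rule injI)
  fix r s assume "interval_cycle r = interval_cycle s"
  then have "card (affected (interval_cycle r)) = card (affected (interval_cycle s))"
    by simp
  then show "r = s"
    by (simp add: affected_interval_cycle split: if_splits)
qed

text \<open>Building the cycle costs two letters per unit and leaves the shift coordinate at
  \<open>r\<close>; returning to \<open>-1\<close> takes \<open>r + 1\<close> further letters. The
  total \<open>3 r + 1\<close> is rounded up to a multiple of \<open>Suc r\<close>.\<close>

lemma word_length_interval_cycle_le:
  "word_length Shuffler std_gens (interval_cycle r, - 1) \<le> 3 * Suc r"
proof -
  interpret group Shuffler by (rule group_Shuffler)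
  note mult_le = word_length_mult_le[OF finite_generating_set_std_gens]
  have gen: "word_length Shuffler std_gens s \<le> 1"
    if "s \<in> std_gens \<union> (\<lambda>s. inv\<^bsub>Shuffler\<^esub> s) ` std_gens" for s
    using that by (intro word_length_generator_le) auto
  have t: "word_length Shuffler std_gens (\<langle>0 \<leftrightarrow> 1\<rangle>, 0) \<le> 1"
    and s: "word_length Shuffler std_gens (1, 1) \<le> 1"
    by (intro gen; simp add: std_gens_def)+
  have s': "word_length Shuffler std_gens (1, - 1) \<le> 1"
    by (intro gen) (auto simp: std_gens_def inv_Shuffler)
  have "word_length Shuffler std_gens (interval_cycle n, int n) \<le> 2 * n" for n
  proof (induction n)
    case 0
    show ?case using word_length_one[of Shuffler std_gens] by simp
  next
    case (Suc n)
    have "word_length Shuffler std_gens (\<langle>0 \<leftrightarrow> 1\<rangle>, 1) \<le> 2"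
      using mult_le[of "(\<langle>0 \<leftrightarrow> 1\<rangle>, 0)" "(1, 1)"] t s by simp
    then show ?case
      using mult_le[of "(interval_cycle n, int n)" "(\<langle>0 \<leftrightarrow> 1\<rangle>, 1)"] Suc.IH by (simp add: add.commute)
  qed
  moreover have "word_length Shuffler std_gens (1, - int n) \<le> n" for n
  proof (induction n)
    case 0
    show ?case using word_length_one[of Shuffler std_gens] by simp
  next
    case (Suc n)
    then show ?case
      using mult_le[of "(1, - 1)" "(1, - int n)"] s' by simp
  qed
  ultimately have "word_length Shuffler std_gens (interval_cycle r, int r) \<le> 2 * r"
    "word_length Shuffler std_gens (1, - int (Suc r)) \<le> Suc r"
    by blast+
  then show ?thesis
    using mult_le[of "(interval_cycle r, int r)" "(1, - int (Suc r))"] by simp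
qed


section \<open>The step distribution\<close>

text \<open>Telescoping, as the summand at k = r + n is 1/(k+1) - 1/(k+2). The case
  \<open>n = 0\<close> normalizes the law \<open>radius\<close>; general \<open>n\<close> gives its
  tail.\<close>

lemma radius_sums: "(\<lambda>r. 1 / ((real (r + n) + 1) * (real (r + n) + 2))) sums (1 / (real n + 1))"
proof -
  have "(\<lambda>r. 1 / (real r + (real n + 1))) \<longlonglongrightarrow> 0"
    by real_asymp
  from telescope_sums'[OF this]
  have "(\<lambda>r. 1 / (real r + (real n + 1)) - 1 / (real (Suc r) + (real n + 1))) sums (1 / (real n + 1))"
    by simp
  moreover have "1 / (real r + (real n + 1)) - 1 / (real (Suc r) + (real n + 1))
      = 1 / ((real (r + n) + 1) * (real (r + n) + 2))" for r
    by (simp add: divide_simps) (simp add: algebra_simps)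
  ultimately show ?thesis
    by simp
qed

definition radius :: "nat pmf"
  where "radius = embed_pmf (\<lambda>r. 1 / ((real r + 1) * (real r + 2)))"

lemma pmf_radius: "pmf radius r = 1 / ((real r + 1) * (real r + 2))"
  unfolding radius_def
proof (rule pmf_embed_pmf)
  have "(\<Sum>r. ennreal (1 / ((real r + 1) * (real r + 2)))) = ennreal 1"
    using radius_sums[of 0] by (intro suminf_ennreal_eq) auto
  then show "(\<integral>\<^sup>+r. ennreal (1 / ((real r + 1) * (real r + 2))) \<partial>count_space UNIV) = 1"
    by (simp add: nn_integral_count_space_nat)
qed auto

lemma prob_radius_ge: "measure_pmf.prob radius {n..} = 1 / (real n + 1)"
proof -
  have "emeasure radius {n..} = (\<integral>\<^sup>+r. ennreal (pmf radius r) \<partial>count_space {n..})"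
    by (simp add: nn_integral_pmf)
  also have "\<dots> = (\<integral>\<^sup>+r. ennreal (pmf radius (r + n)) \<partial>count_space UNIV)"
    by (rule nn_integral_bij_count_space[symmetric])
      (auto simp: bij_betw_def inj_on_def image_iff intro: le_add_diff_inverse2[symmetric])
  also have "\<dots> = (\<Sum>r. ennreal (pmf radius (r + n)))"
    by (rule nn_integral_count_space_nat)
  also have "\<dots> = ennreal (1 / (real n + 1))"
    using radius_sums[of n] by (intro suminf_ennreal_eq) (auto simp: pmf_radius)
  finally show ?thesis
    by (simp add: measure_def)
qed

text \<open>Turns finiteness of an expectation into convergence of a series, where comparison tests
  apply.\<close>

lemma nn_integral_radius:
  assumes "\<And>r. f r \<ge> 0"
  shows "(\<integral>\<^sup>+r. ennreal (f r) \<partial>radius) < \<infinity> \<longleftrightarrow> summable (\<lambda>r. f r * pmf radius r)"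
proof -
  have eq: "ennreal (pmf radius r) * ennreal (f r) = ennreal (f r * pmf radius r)" for r
    using assms[of r] by (subst mult.commute) (rule ennreal_mult[symmetric], auto)
  have "(\<integral>\<^sup>+r. ennreal (f r) \<partial>radius) = (\<Sum>r. ennreal (f r * pmf radius r))"
    by (simp only: nn_integral_measure_pmf nn_integral_count_space_nat eq)
  moreover have "(\<Sum>r. ennreal (f r * pmf radius r)) < \<infinity> \<longleftrightarrow> summable (\<lambda>r. f r * pmf radius r)"
    unfolding infinity_ennreal_def less_top[symmetric]
  proof
    assume "(\<Sum>r. ennreal (f r * pmf radius r)) \<noteq> \<top>"
    then show "summable (\<lambda>r. f r * pmf radius r)"
      using assms by (intro summable_suminf_not_top) auto
  next
    assume "summable (\<lambda>r. f r * pmf radius r)"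
    then show "(\<Sum>r. ennreal (f r * pmf radius r)) \<noteq> \<top>"
      using assms by (intro ennreal_suminf_neq_top) auto
  qed
  ultimately show ?thesis
    by (simp only:)
qed

lemma not_summable_radius: "\<not> summable (\<lambda>r. real r * pmf radius r)"
proof
  assume "summable (\<lambda>r. real r * pmf radius r)"
  then have "summable (\<lambda>r. real (Suc r) * pmf radius (Suc r))"
    by (subst summable_Suc_iff)
  \<comment> \<open>The factor 6 allows comparison with the harmonic series: 6(r+1)^2 \<ge>
    (r+2)(r+3), with equality at r = 0.\<close>
  then have "summable (\<lambda>r. 6 * (real (Suc r) * pmf radius (Suc r)))"
    by (rule summable_mult)
  then have "summable (\<lambda>r. inverse (real (Suc r)))"
  proof (rule summable_comparison_test'[where N = 0])
    fix r :: nat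
    show "norm (inverse (real (Suc r))) \<le> 6 * (real (Suc r) * pmf radius (Suc r))"
      by (simp add: pmf_radius divide_simps) (simp add: algebra_simps)
  qed
  then have "summable (\<lambda>r. inverse (real r))"
    by (subst (asm) summable_Suc_iff)
  then show False
    using not_summable_harmonic[where 'a = real] by blast
qed

text \<open>The mass at \<open>r\<close> is at most (r+1)^(-2), so the terms are dominated by the
  convergent series of (r+1)^(-1-\<epsilon>). The base \<open>Suc r\<close> dominates both support
  size and, up to a factor 3, word length.\<close>

lemma summable_radius_powr:
  assumes "0 < \<epsilon>"
  shows "summable (\<lambda>r. real (Suc r) powr (1 - \<epsilon>) * pmf radius r)"
proof (rule summable_comparison_test'[where N = 0])
  show "summable (\<lambda>r. real (Suc r) powr (- 1 - \<epsilon>))"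
    using assms summable_real_powr_iff[of "- 1 - \<epsilon>"]
      summable_Suc_iff[of "\<lambda>r. real r powr (- 1 - \<epsilon>)"] by simp
  fix r :: nat
  have "pmf radius r \<le> real (Suc r) powr (- 2)"
    by (simp add: pmf_radius powr_minus divide_simps power2_eq_square) (simp add: algebra_simps)
  then have "real (Suc r) powr (1 - \<epsilon>) * pmf radius r
      \<le> real (Suc r) powr (1 - \<epsilon>) * real (Suc r) powr (- 2)"
    by (intro mult_left_mono) auto
  also have "\<dots> = real (Suc r) powr (- 1 - \<epsilon>)"
    by (simp flip: powr_add)
  finally show "norm (real (Suc r) powr (1 - \<epsilon>) * pmf radius r) \<le> real (Suc r) powr (- 1 - \<epsilon>)"
    by simp
qed

text \<open>The shift \<open>-1\<close> puts the walk at -n after n steps. Seen from there the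
  origin is the point n, which the next cycle moves as soon as its radius reaches n.\<close>

definition step :: "nat \<Rightarrow> int perm \<times> int"
  where "step r = (interval_cycle r, - 1)"

lemma inj_step: "inj step"
  using inj_interval_cycle by (auto simp: step_def inj_def)

definition step_pmf :: "(int perm \<times> int) pmf"
  where "step_pmf = map_pmf step radius"

text \<open>The law vanishes off \<open>range step\<close>, and injectivity of \<open>step\<close>
  reindexes the remaining sum by the radius.\<close>

lemma summable_on_step_pmf:
  fixes f :: "int perm \<times> int \<Rightarrow> real"
  assumes "\<And>g. f g \<ge> 0"
  shows "(\<lambda>g. f g * pmf step_pmf g) summable_on UNIV \<longleftrightarrow> summable (\<lambda>r. f (step r) * pmf radius r)"
proof -
  have "(\<lambda>g. f g * pmf step_pmf g) summable_on UNIV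
      \<longleftrightarrow> (\<lambda>g. f g * pmf step_pmf g) summable_on range step"
    by (rule summable_on_cong_neutral) (auto simp: step_pmf_def pmf_eq_0_set_pmf)
  also have "\<dots> \<longleftrightarrow> (\<lambda>r. f (step r) * pmf radius r) summable_on UNIV"
    by (simp add: summable_on_reindex[OF inj_step] comp_def step_pmf_def pmf_map_inj'[OF inj_step])
  also have "\<dots> \<longleftrightarrow> summable (\<lambda>r. f (step r) * pmf radius r)"
    using assms by (intro summable_on_UNIV_nonneg_real_iff) auto
  finally show ?thesis .
qed

section \<open>Moments of the increment law\<close>

lemma card_affected_step: "card (affected (fst (step r))) = (if r = 0 then 0 else Suc r)"
  by (simp add: step_def affected_interval_cycle nat_add_distrib)

text \<open>For every finite generating set the word length of \<open>step r\<close> is at least a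
  constant multiple of the support size, hence of \<open>r\<close>, whose mean is infinite.\<close>

lemma not_finite_moment_1: "\<not> finite_moment step_pmf 1"
proof
  assume "finite_moment step_pmf 1"
  then obtain S where S: "finite_generating_set Shuffler S"
    and "(\<lambda>g. real (word_length Shuffler S g) powr 1 * pmf step_pmf g) summable_on UNIV"
    unfolding finite_moment_def by blast
  then have sum: "summable (\<lambda>r. real (word_length Shuffler S (step r)) * pmf radius r)"
    by (simp add: summable_on_step_pmf)
  obtain K where K: "\<And>g. card (affected (fst g)) \<le> K * word_length Shuffler S g"
    using card_affected_le_word_length[OF S] by blast
  have "summable (\<lambda>r. real r * pmf radius r)"
  proof (rule summable_comparison_test'[where N = 0])
    show "summable (\<lambda>r. real K * (real (word_length Shuffler S (step r)) * pmf radius r))"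
      by (intro summable_mult sum)
    fix r
    have "r \<le> K * word_length Shuffler S (step r)"
      using K[of "step r"] by (simp add: card_affected_step split: if_splits)
    then have "real r \<le> real K * real (word_length Shuffler S (step r))"
      by (metis of_nat_le_iff of_nat_mult)
    then show "norm (real r * pmf radius r)
        \<le> real K * (real (word_length Shuffler S (step r)) * pmf radius r)"
      by (simp add: mult_right_mono flip: mult.assoc)
  qed
  then show False
    using not_summable_radius by blast
qed

lemma finite_moment_less_1:
  assumes "0 < \<epsilon>" "\<epsilon> < 1"
  shows "finite_moment step_pmf (1 - \<epsilon>)"
proof -
  have "summable (\<lambda>r. real (word_length Shuffler std_gens (step r)) powr (1 - \<epsilon>) * pmf radius r)"
  proof (rule summable_comparison_test'[where N = 0])
    show "summable (\<lambda>r. 3 powr (1 - \<epsilon>) * (real (Suc r) powr (1 - \<epsilon>) * pmf radius r))"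
      by (intro summable_mult summable_radius_powr assms)
    fix r
    have "real (word_length Shuffler std_gens (step r)) \<le> 3 * real (Suc r)"
      using word_length_interval_cycle_le[of r]
      by (metis step_def of_nat_le_iff of_nat_mult of_nat_numeral)
    then have "real (word_length Shuffler std_gens (step r)) powr (1 - \<epsilon>)
        \<le> (3 * real (Suc r)) powr (1 - \<epsilon>)"
      using assms by (intro powr_mono2) auto
    also have "\<dots> = 3 powr (1 - \<epsilon>) * real (Suc r) powr (1 - \<epsilon>)"
      by (rule powr_mult)
    finally show "norm (real (word_length Shuffler std_gens (step r)) powr (1 - \<epsilon>) * pmf radius r)
        \<le> 3 powr (1 - \<epsilon>) * (real (Suc r) powr (1 - \<epsilon>) * pmf radius r)"
      by (simp add: mult_right_mono flip: mult.assoc)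
  qed
  then show ?thesis
    unfolding finite_moment_def using finite_generating_set_std_gens
    by (intro exI[of _ std_gens]) (simp add: summable_on_step_pmf)
qed

lemma nn_integral_card_affected:
  "(\<integral>\<^sup>+ g. ennreal (real (card (affected (fst g)))) \<partial>measure_pmf step_pmf) = \<infinity>"
proof -
  have "\<not> summable (\<lambda>r. real (card (affected (fst (step r)))) * pmf radius r)"
  proof
    assume *: "summable (\<lambda>r. real (card (affected (fst (step r)))) * pmf radius r)"
    have "summable (\<lambda>r. real r * pmf radius r)"
      by (rule summable_comparison_test'[OF *, where N = 0])
        (auto simp: card_affected_step intro!: mult_right_mono)
    then show False
      using not_summable_radius by blast
  qed
  then show ?thesis
    using nn_integral_radius[of "\<lambda>r. real (card (affected (fst (step r))))"]
    by (simp add: step_pmf_def less_top[symmetric])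
qed

lemma nn_integral_card_affected_powr:
  assumes "0 < \<epsilon>" "\<epsilon> < 1"
  shows "(\<integral>\<^sup>+ g. ennreal (real (card (affected (fst g))) powr (1 - \<epsilon>)) \<partial>measure_pmf step_pmf) < \<infinity>"
proof -
  have "summable (\<lambda>r. real (card (affected (fst (step r)))) powr (1 - \<epsilon>) * pmf radius r)"
    by (rule summable_comparison_test'[OF summable_radius_powr[OF assms(1)], where N = 0])
      (use assms in \<open>auto simp: card_affected_step intro!: mult_right_mono\<close>)
  then show ?thesis
    using nn_integral_radius[of "\<lambda>r. real (card (affected (fst (step r)))) powr (1 - \<epsilon>)"]
    by (simp add: step_pmf_def)
qed


section \<open>The random walk\<close>

text \<open>Countably many almost sure events are intersected, so that the shift coordinate can then
  be treated as deterministic.\<close>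

lemma AE_increments_range: "AE \<omega> in increments step_pmf. \<forall>n. \<omega> n \<in> range step"
  unfolding AE_all_countable
proof
  fix n :: nat
  interpret product_prob_space "\<lambda>_. measure_pmf step_pmf" "UNIV :: nat set"
    by unfold_locales
  show "AE \<omega> in increments step_pmf. \<omega> n \<in> range step"
    unfolding increments_def
    by (rule AE_component) (auto simp: AE_measure_pmf_iff step_pmf_def)
qed

section \<open>Deterministic drift and transience\<close>

lemma snd_walk:
  assumes "\<And>n. \<omega> n \<in> range step"
  shows "snd (walk \<omega> n) = - int n"
proof (induction n)
  case (Suc n)
  obtain f y where 1: "walk \<omega> n = (f, y)" by (metis surj_pair)
  obtain r where 2: "\<omega> n = step r" using assms by blast
  show ?case
    using Suc.IH by (simp add: 1 2 step_def)
qed auto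

lemma transient_step_pmf: "induced_walk_transient step_pmf"
  unfolding induced_walk_transient_def
  using AE_increments_range
proof eventually_elim
  case (elim \<omega>)
  then have "{n. snd (walk \<omega> n) = 0} = {0}"
    by (auto simp: snd_walk)
  then show ?case by simp
qed

text \<open>The new permutation is the old one composed with the increment translated to the current
  position. The old one is injective, so the image of \<open>h\<close> changes exactly when the
  translated increment moves \<open>h\<close>.\<close>

lemma fst_walk_Suc:
  "fst (walk \<omega> (Suc n)) \<langle>$\<rangle> h = fst (walk \<omega> n) \<langle>$\<rangle> h
    \<longleftrightarrow> h - snd (walk \<omega> n) \<notin> affected (fst (\<omega> n))"
proof -
  obtain f y where 1: "walk \<omega> n = (f, y)" by (metis surj_pair)
  obtain g z where 2: "\<omega> n = (g, z)" by (metis surj_pair)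
  show ?thesis
    by (auto simp: 1 2 apply_times apply_translate in_affected apply_inj algebra_simps)
qed

section \<open>The image of 0 changes infinitely often\<close>

lemma prob_unaffected:
  assumes "n \<ge> 1"
  shows "measure_pmf.prob step_pmf {g. int n \<notin> affected (fst g)} = real n / (real n + 1)"
proof -
  \<comment> \<open>Positivity of \<open>n\<close> matters: at \<open>n = 0\<close> the radius 0
    satisfies \<open>r \<ge> n\<close>, yet its cycle is the identity and moves nothing.\<close>
  have "step -` {g. int n \<notin> affected (fst g)} = UNIV - {n..}"
    using assms by (auto simp: step_def affected_interval_cycle)
  then have "measure_pmf.prob step_pmf {g. int n \<notin> affected (fst g)} = 1 - 1 / (real n + 1)"
    using measure_pmf.prob_compl[of "{n..}" radius] by (simp add: step_pmf_def prob_radius_ge)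
  then show ?thesis
    by (simp add: field_simps)
qed

lemma prod_telescope:
  assumes "1 \<le> N" "N \<le> M"
  shows "(\<Prod>n\<in>{N..<M}. real n / (real n + 1)) = real N / real M"
  using assms(2,1) by (induction M rule: dec_induct) (auto simp: field_simps)

text \<open>By independence, the probability that none of the events with index in
  \<open>{N..<M}\<close> occurs is a telescoping product equal to N/M, which tends to 0. This
  replaces an appeal to the second Borel-Cantelli lemma.\<close>

lemma AE_affected_infinitely_often:
  assumes "N \<ge> 1"
  shows "AE \<omega> in increments step_pmf. \<exists>n\<ge>N. int n \<in> affected (fst (\<omega> n))"
proof -
  interpret P: product_prob_space "\<lambda>_. measure_pmf step_pmf" "UNIV :: nat set"
    by unfold_locales
  let ?B = "\<lambda>n. {g. int n \<notin> affected (fst g)}"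
  let ?E = "\<lambda>M. {\<omega> \<in> space (increments step_pmf). \<forall>n\<in>{N..<M}. \<omega> n \<in> ?B n}"
  let ?Z = "\<Inter>M. ?E M"
  have meas: "?E M \<in> sets (increments step_pmf)" for M
    unfolding increments_def by (intro sets.sets_Collect_finite_All sets_Collect_single) auto
  have prob: "emeasure (increments step_pmf) (?E M) = ennreal (real N / real M)" if "N \<le> M" for M
  proof -
    have "emeasure (increments step_pmf) (?E M)
        = (\<Prod>n\<in>{N..<M}. emeasure (measure_pmf step_pmf) (?B n))"
      unfolding increments_def by (rule P.emeasure_PiM_Collect) auto
    also have "\<dots> = (\<Prod>n\<in>{N..<M}. ennreal (real n / (real n + 1)))"
      using assms by (intro prod.cong)
        (simp_all add: measure_pmf.emeasure_eq_measure prob_unaffected)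
    also have "\<dots> = ennreal (real N / real M)"
      using assms that by (subst prod_ennreal) (auto simp: prod_telescope)
    finally show ?thesis .
  qed
  have "emeasure (increments step_pmf) ?Z \<le> 0"
  proof (rule LIMSEQ_le_const)
    show "(\<lambda>M. ennreal (real N / real M)) \<longlonglongrightarrow> 0"
      using tendsto_ennrealI[of "\<lambda>M. real N / real M" 0] by (simp add: lim_const_over_n)
    \<comment> \<open>The event \<open>?Z\<close> that no change ever occurs from \<open>N\<close>
      on lies in every \<open>?E M\<close>, and for \<open>M \<ge> N\<close> the measure of
      \<open>?E M\<close> is known.\<close>
    show "\<exists>M0. \<forall>M\<ge>M0. emeasure (increments step_pmf) ?Z \<le> ennreal (real N / real M)"
      by (metis (no_types, lifting) INT_lower UNIV_I emeasure_mono meas prob)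
  qed
  then have "?Z \<in> null_sets (increments step_pmf)"
    using meas by (auto simp: null_sets_def)
  then show ?thesis
    by (rule AE_I') (auto simp: not_less)
qed

lemma not_stabilizes_step_pmf: "\<not> permutation_stabilizes step_pmf"
proof
  assume "permutation_stabilizes step_pmf"
  then have stab: "AE \<omega> in increments step_pmf. \<forall>h. \<exists>N\<ge>1. \<forall>n\<ge>N.
      fst (walk \<omega> n) \<langle>$\<rangle> h = fst (walk \<omega> N) \<langle>$\<rangle> h"
    by (simp add: permutation_stabilizes_def)
  have moves: "AE \<omega> in increments step_pmf. \<forall>N. N \<ge> 1 \<longrightarrow> (\<exists>n\<ge>N. int n \<in> affected (fst (\<omega> n)))"
    unfolding AE_all_countable using AE_affected_infinitely_often by auto
  interpret P: product_prob_space "\<lambda>_. measure_pmf step_pmf" "UNIV :: nat set"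
    by unfold_locales
  \<comment> \<open>Stabilization is itself an almost sure statement, so it is intersected with the
    other two; an almost surely false statement is impossible on a probability space.\<close>
  have "AE \<omega> in increments step_pmf. False"
    using stab moves AE_increments_range
  proof eventually_elim
    case (elim \<omega>)
    from elim(1) obtain N where N: "N \<ge> 1"
      "\<And>n. n \<ge> N \<Longrightarrow> fst (walk \<omega> n) \<langle>$\<rangle> 0 = fst (walk \<omega> N) \<langle>$\<rangle> 0"
      by blast
    from elim(2) N(1) obtain n where n: "n \<ge> N" "int n \<in> affected (fst (\<omega> n))"
      by blast
    have "fst (walk \<omega> (Suc n)) \<langle>$\<rangle> 0 = fst (walk \<omega> n) \<langle>$\<rangle> 0"
      using N(2)[of n] N(2)[of "Suc n"] n(1) by (simp del: walk.simps)
    \<comment> \<open>With h = 0 and the walk at -n, the point tested by \<open>fst_walk_Suc\<close>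
      is n itself.\<close>
    then have "int n \<notin> affected (fst (\<omega> n))"
      using elim(3) by (simp add: fst_walk_Suc snd_walk del: walk.simps)
    with n(2) show False by blast
  qed
  then show False
    unfolding increments_def by (simp add: P.AE_False)
qed

theorem proposition4p9:
  shows "\<exists>\<mu> :: (int perm \<times> int) pmf.
    \<not> finite_moment \<mu> 1
    \<and> (\<forall>\<epsilon>::real. 0 < \<epsilon> \<and> \<epsilon> < 1 \<longrightarrow> finite_moment \<mu> (1 - \<epsilon>))
    \<and> induced_walk_transient \<mu>
    \<and> \<not> permutation_stabilizes \<mu>
    \<and> (\<integral>\<^sup>+ g. ennreal (real (card (affected (fst g)))) \<partial>measure_pmf \<mu>) = \<infinity>
    \<and> (\<forall>\<epsilon>::real. 0 < \<epsilon> \<and> \<epsilon> < 1 \<longrightarrow>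
        (\<integral>\<^sup>+ g. ennreal (real (card (affected (fst g))) powr (1 - \<epsilon>)) \<partial>measure_pmf \<mu>) < \<infinity>)"
  using not_finite_moment_1 finite_moment_less_1 transient_step_pmf not_stabilizes_step_pmf
    nn_integral_card_affected nn_integral_card_affected_powr
  by (intro exI[of _ step_pmf]) blast

end
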